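(* Consider the adversarial convex body chasing game described in the context, with Lipschitz constants $L_c$, $L_\Theta$, $L_{v,t}$ as there. Let $\delta_{\mathcal X}=(\delta_{\mathcal X,0},\dots,\delta_{\mathcal X,T})$ be nonnegative reals and let $\widehat{\mathcal X}_0,\dots,\widehat{\mathcal X}_T\subseteq\mathcal X$ be finite meshes satisfying the discretization conditions (D1)–(D3) of the context. Then the discretized game value $\widehat U_0(\mathcal G,\mathcal Q)$ exceeds the optimal game value $U_0(\mathcal G,\mathcal Q)$ by at most $$\varepsilon(\delta_{\mathcal X})=\sum_{\tau=1}^{T-1}(L_c+L_{v,\tau+1})\delta_{\mathcal X,\tau}+L_{v,1}\delta_{\mathcal X,0}+L_c\delta_{\mathcal X,T},$$ that is, $0\le\widehat U_0(\mathcal G,\mathcal Q)-U_0(\mathcal G,\mathcal Q)\le\varepsilon(\delta_{\mathcal X})$.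
   Context: Setting. $\mathcal X$ is a compact subset of $\mathbb R^d$ equipped with a norm $\|\cdot\|$; $T\ge 1$ is an integer horizon. A set is solid if it has nonempty interior. A correspondence (set-valued map) $F:A\rightsquigarrow B$ assigns to each point of $A$ a subset of $B$. It is upper semi-continuous at $\mathbf x\in A$ if for every open $O\subseteq B$ with $F(\mathbf x)\subseteq O$ there is a neighborhood $N$ of $\mathbf x$ with $F(\mathbf x')\subseteq O$ for all $\mathbf x'\in N$; lower semi-continuous at $\mathbf x$ if for every open $O\subseteq B$ with $F(\mathbf x)\cap O\ne\emptyset$ there is a neighborhood $N$ of $\mathbf x$ with $F(\mathbf x')\cap O\neq\emptyset$ for all $\mathbf x'\in N$; continuous if it is both at every point. The Hausdorff distance is $\mathrm{dist}_{\mathrm H}(E,F)=\max\{\sup_{\mathbf x\in E}\inf_{\mathbf y\in F}\|\mathbf x-\mathbf y\|,\ \sup_{\mathbf y\in F}\inf_{\mathbf x\in E}\|\mathbf x-\mathbf y\|\}$. Data. $\mathcal G=(\mathcal V,\mathcal E)$ is a finite directed graph with $\mathcal V\ne\emptyset$, $\mathcal N_i=\{j\in\mathcal V:(i,j)\in\mathcal E\}$, assumed nonempty for each $i\in\mathcal V$. $\mathcal Q=\{\mathcal Q_t^{(i)}\}_{t=0,\dots,T;\,i\in\mathcal V}$ is a collection of subsets of $\mathcal X$. $\mathcal R:\mathcal X\rightsquigarrow\mathcal X$ is the reachability correspondence, and $c:\mathcal X\times\mathcal X\to\mathbb R$ is a nonnegative cost function. Write $\Theta_t^{(j)}(\mathbf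 x)=\mathcal R(\mathbf x)\cap\mathcal Q_t^{(j)}$. Assumptions. (1) $\mathcal R(\mathbf x)$ is solid, compact and convex for all $\mathbf x\in\mathcal X$. (2) Each $\mathcal Q_t^{(i)}$ is solid, compact and convex. (3) For all $t\in\{1,\dots,T\}$, $i\in\mathcal V$, $j\in\mathcal N_i$ and $\mathbf x\in\mathcal Q_{t-1}^{(i)}$: $\mathrm{int}(\mathcal R(\mathbf x)\cap\mathcal Q_t^{(j)})\neq\emptyset$ (interior in $\mathbb R^d$). (4) $\mathcal R$ is continuous. (5) $|c(\mathbf x,\mathbf y)-c(\mathbf x',\mathbf y')|\le L_c(\|\mathbf x-\mathbf x'\|+\|\mathbf y-\mathbf y'\|)$ for all $(\mathbf x,\mathbf y),(\mathbf x',\mathbf y')\in\mathcal X\times\mathcal X$, with $L_c\ge0$. (6) $\mathrm{dist}_{\mathrm H}(\Theta_t^{(i)}(\mathbf x),\Theta_t^{(i)}(\mathbf x'))\le L_\Theta\|\mathbf x-\mathbf x'\|$ for all $t\in\{1,\dots,T\}$, $i,j\in\mathcal V$ with $i\in\mathcal N_j$, and $\mathbf x,\mathbf x'\in\mathcal Q_{t-1}^{(j)}$, with $L_\Theta\ge 0$. Set $L_{v,t}=L_c\sum_{k=1}^{T-t+1}(1+L_\Theta)^k$ for $t\in\{1,\dots,T\}$. Optimal game value. For $i\in\mathcal V$, $\mathbf x\in\mathcal Q_{t-1}^{(i)}$ define by backward recursion (the infima are attained under these assumptions, so $\inf$ may be read as $\min$) $$U_T(\mathbf x,i)=\max_{j\in\mathcal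 N_i}\ \inf_{\mathbf y\in\Theta_T^{(j)}(\mathbf x)}c(\mathbf x,\mathbf y),\qquad U_t(\mathbf x,i)=\max_{j\in\mathcal N_i}\ \inf_{\mathbf y\in\Theta_t^{(j)}(\mathbf x)}\{c(\mathbf x,\mathbf y)+U_{t+1}(\mathbf y,j)\}\ (1\le t\le T-1),$$ $$U_0(\mathcal G,\mathcal Q)=\max_{i\in\mathcal V}\ \inf_{\mathbf x\in\mathcal Q_0^{(i)}}U_1(\mathbf x,i).$$ Discretization conditions (all sets over which minima are taken are in particular nonempty). (D1) $\min_{\widehat{\mathbf x}\in\widehat{\mathcal X}_t}\|\widehat{\mathbf x}-\mathbf x\|\le\delta_{\mathcal X,t}$ for all $\mathbf x\in\mathcal X$, $t\in\{0,\dots,T\}$. (D2) $\min_{\widehat{\mathbf x}\in\widehat{\mathcal X}_0\cap\mathcal Q_0^{(i)}}\|\widehat{\mathbf x}-\mathbf x\|\le\delta_{\mathcal X,0}$ for all $i\in\mathcal V$, $\mathbf x\in\mathcal Q_0^{(i)}$. (D3) For all $t\in\{1,\dots,T\}$, $j\in\mathcal V$, $i\in\mathcal N_j$, $\widehat{\mathbf x}_{t-1}\in\widehat{\mathcal X}_{t-1}\cap\mathcal Q_{t-1}^{(j)}$ and $\mathbf x\in\Theta_t^{(i)}(\widehat{\mathbf x}_{t-1})$: $\min_{\widehat{\mathbf x}\in\widehat{\mathcal X}_t\cap\Theta_t^{(i)}(\widehat{\mathbf x}_{t-1})}\|\widehat{\mathbf x}-\mathbf x\|\le\delta_{\mathcal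 X,t}$. Discretized game value. For $i\in\mathcal V$, $\widehat{\mathbf x}\in\widehat{\mathcal X}_{t-1}\cap\mathcal Q_{t-1}^{(i)}$: $$\widehat U_T(\widehat{\mathbf x},i)=\max_{j\in\mathcal N_i}\ \min_{\widehat{\mathbf y}\in\widehat{\mathcal X}_T\cap\Theta_T^{(j)}(\widehat{\mathbf x})}c(\widehat{\mathbf x},\widehat{\mathbf y}),\qquad \widehat U_t(\widehat{\mathbf x},i)=\max_{j\in\mathcal N_i}\ \min_{\widehat{\mathbf y}\in\widehat{\mathcal X}_t\cap\Theta_t^{(j)}(\widehat{\mathbf x})}\{c(\widehat{\mathbf x},\widehat{\mathbf y})+\widehat U_{t+1}(\widehat{\mathbf y},j)\}\ (1\le t\le T-1),$$ $$\widehat U_0(\mathcal G,\mathcal Q)=\max_{i\in\mathcal V}\ \min_{\widehat{\mathbf x}\in\widehat{\mathcal X}_0\cap\mathcal Q_0^{(i)}}\widehat U_1(\widehat{\mathbf x},i).$$ *)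

theory Defs
  imports "HOL-Analysis.Analysis"
begin

text \<open>
  The norm on \<open>\<real>\<^sup>d\<close> is arbitrary, hence an explicit function rather than the Euclidean
  \<open>norm\<close> of the type class.  All norms on \<open>\<real>\<^sup>d\<close> induce the same topology, so open sets,
  compactness and interiors are those of the type class.
\<close>

definition is_norm :: "('a::real_vector \<Rightarrow> real) \<Rightarrow> bool" where
  "is_norm N \<longleftrightarrow>
     (\<forall>x. 0 \<le> N x) \<and> (\<forall>x. N x = 0 \<longleftrightarrow> x = 0) \<and>
     (\<forall>a x. N (a *\<^sub>R x) = \<bar>a\<bar> * N x) \<and> (\<forall>x y. N (x + y) \<le> N x + N y)"

definition solid :: "'a::topological_space set \<Rightarrow> bool" where
  "solid S \<longleftrightarrow> interior S \<noteq> {}"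

text \<open>A correspondence from \<open>A\<close> to \<open>B\<close> is a set-valued function of which only the
  restriction to \<open>A\<close> matters; open sets and neighbourhoods are relative to \<open>B\<close> and \<open>A\<close>.\<close>

definition correspondence :: "'a set \<Rightarrow> 'b set \<Rightarrow> ('a \<Rightarrow> 'b set) \<Rightarrow> bool" where
  "correspondence A B F \<longleftrightarrow> (\<forall>x\<in>A. F x \<subseteq> B)"

definition upper_semicontinuous_at ::
    "'a::topological_space set \<Rightarrow> 'b::topological_space set \<Rightarrow> ('a \<Rightarrow> 'b set) \<Rightarrow> 'a \<Rightarrow> bool" where
  "upper_semicontinuous_at A B F x \<longleftrightarrow>
     (\<forall>S. openin (top_of_set B) S \<and> F x \<subseteq> S \<longrightarrow>
        (\<exists>W. openin (top_of_set A) W \<and> x \<in> W \<and> (\<forall>x'\<in>W. F x' \<subseteq> S)))"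

definition lower_semicontinuous_at ::
    "'a::topological_space set \<Rightarrow> 'b::topological_space set \<Rightarrow> ('a \<Rightarrow> 'b set) \<Rightarrow> 'a \<Rightarrow> bool" where
  "lower_semicontinuous_at A B F x \<longleftrightarrow>
     (\<forall>S. openin (top_of_set B) S \<and> F x \<inter> S \<noteq> {} \<longrightarrow>
        (\<exists>W. openin (top_of_set A) W \<and> x \<in> W \<and> (\<forall>x'\<in>W. F x' \<inter> S \<noteq> {})))"

definition continuous_correspondence ::
    "'a::topological_space set \<Rightarrow> 'b::topological_space set \<Rightarrow> ('a \<Rightarrow> 'b set) \<Rightarrow> bool" where
  "continuous_correspondence A B F \<longleftrightarrow>
     (\<forall>x\<in>A. upper_semicontinuous_at A B F x \<and> lower_semicontinuous_at A B F x)"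

text \<open>Suprema and infima of reals: meaningful for nonempty bounded sets only.\<close>

definition hausdorff_dist :: "('a::real_vector \<Rightarrow> real) \<Rightarrow> 'a set \<Rightarrow> 'a set \<Rightarrow> real" where
  "hausdorff_dist N E F =
     max (SUP x\<in>E. INF y\<in>F. N (x - y)) (SUP y\<in>F. INF x\<in>E. N (x - y))"

definition neighbors :: "'v set \<Rightarrow> ('v \<times> 'v) set \<Rightarrow> 'v \<Rightarrow> 'v set" where
  "neighbors V E i = {j \<in> V. (i, j) \<in> E}"

definition Theta :: "('a \<Rightarrow> 'a set) \<Rightarrow> (nat \<Rightarrow> 'v \<Rightarrow> 'a set) \<Rightarrow> nat \<Rightarrow> 'v \<Rightarrow> 'a \<Rightarrow> 'a set" where
  "Theta R Q t j x = R x \<inter> Q t j"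

context
  fixes V :: "'v set"
    and E :: "('v \<times> 'v) set"
    and Q :: "nat \<Rightarrow> 'v \<Rightarrow> 'a set"
    and R :: "'a \<Rightarrow> 'a set"
    and c :: "'a \<Rightarrow> 'a \<Rightarrow> real"
    and T :: nat
begin

text \<open>Backward recursion from stage \<open>T\<close>; only stages \<open>1 \<le> t \<le> T\<close> are meaningful.\<close>

function game_value :: "nat \<Rightarrow> 'a \<Rightarrow> 'v \<Rightarrow> real" where
  "game_value t x i =
     (if t < T
      then MAX j\<in>neighbors V E i. INF y\<in>Theta R Q t j x. c x y + game_value (Suc t) y j
      else MAX j\<in>neighbors V E i. INF y\<in>Theta R Q t j x. c x y)"
  by auto
termination by (relation "Wellfounded.measure (\<lambda>(t, _, _). T - t)") auto

definition optimal_value :: real where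
  "optimal_value = (MAX i\<in>V. INF x\<in>Q 0 i. game_value 1 x i)"

context
  fixes Xh :: "nat \<Rightarrow> 'a set"
begin

function discrete_game_value :: "nat \<Rightarrow> 'a \<Rightarrow> 'v \<Rightarrow> real" where
  "discrete_game_value t x i =
     (if t < T
      then MAX j\<in>neighbors V E i. MIN y\<in>Xh t \<inter> Theta R Q t j x.
             c x y + discrete_game_value (Suc t) y j
      else MAX j\<in>neighbors V E i. MIN y\<in>Xh t \<inter> Theta R Q t j x. c x y)"
  by auto
termination by (relation "Wellfounded.measure (\<lambda>(t, _, _). T - t)") auto

definition discrete_value :: real where
  "discrete_value = (MAX i\<in>V. MIN x\<in>Xh 0 \<inter> Q 0 i. discrete_game_value 1 x i)"

end

end

declare game_value.simps [simp del] discrete_game_value.simps [simp del]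

definition Lv :: "real \<Rightarrow> real \<Rightarrow> nat \<Rightarrow> nat \<Rightarrow> real" where
  "Lv Lc L\<Theta> T t = Lc * (\<Sum>k=1..T - t + 1. (1 + L\<Theta>) ^ k)"

definition discretization_error :: "real \<Rightarrow> real \<Rightarrow> nat \<Rightarrow> (nat \<Rightarrow> real) \<Rightarrow> real" where
  "discretization_error Lc L\<Theta> T \<delta> =
     (\<Sum>\<tau>=1..T - 1. (Lc + Lv Lc L\<Theta> T (\<tau> + 1)) * \<delta> \<tau>) + Lv Lc L\<Theta> T 1 * \<delta> 0 + Lc * \<delta> T"

end

theory Submission
  imports Defs
begin

text \<open>
  Moving the state from \<open>x\<close> to \<open>x'\<close> changes the stage cost by \<open>Lc\<close> times the displacement of both
  arguments and the feasible set by \<open>L\<Theta>\<close> times that of \<open>x\<close>; backward induction thus makes \<open>U\<^sub>t\<close>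
  Lipschitz with constant \<open>Lv t\<close>.  Restricting the minimisation at stage \<open>t\<close> to the mesh costs at
  most \<open>(Lc + Lv (t + 1)) \<delta>\<^sub>t\<close>, because the minimised function is Lipschitz with constant
  \<open>Lc + Lv (t + 1)\<close> (\<open>Lc\<close> at the last stage), and these losses add up along the recursion.
\<close>

section \<open>Comparison of an arbitrary norm with the Euclidean one\<close>

lemma is_norm_sum_le:
  assumes N: "is_norm N"
  shows "N (sum f A) \<le> (\<Sum>a\<in>A. N (f a))"
proof (induction A rule: infinite_finite_induct)
  case (insert a A)
  have "N (f a + sum f A) \<le> N (f a) + N (sum f A)"
    using N unfolding is_norm_def by blast
  with insert show ?case by simp
qed (use N in \<open>simp_all add: is_norm_def order_eq_refl\<close>)

text \<open>Expand \<open>x\<close> in \<open>Basis\<close>: by subadditivity and homogeneity, each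
  coordinate contributes at most \<open>N b * norm x\<close>. This half of the equivalence of norms
  carries Euclidean boundedness over to \<open>N\<close>.\<close>

lemma is_norm_le_norm:
  fixes N :: "'a::euclidean_space \<Rightarrow> real"
  assumes N: "is_norm N"
  shows "N x \<le> (\<Sum>b\<in>Basis. N b) * norm x"
proof -
  have "N x = N (\<Sum>b\<in>Basis. (x \<bullet> b) *\<^sub>R b)"
    by (simp add: euclidean_representation)
  also have "\<dots> \<le> (\<Sum>b\<in>Basis. N ((x \<bullet> b) *\<^sub>R b))"
    by (rule is_norm_sum_le[OF N])
  also have "\<dots> \<le> (\<Sum>b\<in>Basis. N b * norm x)"
    using N by (intro sum_mono) (auto simp: is_norm_def mult.commute Basis_le_norm intro!: mult_left_mono)
  finally show ?thesis by (simp add: sum_distrib_right)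
qed

text \<open>Supplies the uniform bound under which the suprema in \<open>hausdorff_dist\<close> are
  genuine least upper bounds.\<close>

lemma is_norm_bounded_diff:
  fixes N :: "'a::euclidean_space \<Rightarrow> real"
  assumes N: "is_norm N" and X: "bounded X"
  obtains B where "\<forall>x\<in>X. \<forall>y\<in>X. N (x - y) \<le> B"
proof -
  obtain b where b: "\<forall>x\<in>X. norm x \<le> b"
    using X unfolding bounded_iff by blast
  define S where "S = (\<Sum>b\<in>Basis. N b)"
  have "0 \<le> S" unfolding S_def using N by (auto simp: is_norm_def intro: sum_nonneg)
  have "N (x - y) \<le> S * (b + b)" if "x \<in> X" "y \<in> X" for x y
  proof -
    have "norm (x - y) \<le> b + b"
      using b that by (meson add_mono norm_triangle_ineq4 order_trans)
    then show ?thesis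
      using is_norm_le_norm[OF N, of "x - y"] \<open>0 \<le> S\<close>
      unfolding S_def[symmetric] by (meson mult_left_mono order_trans)
  qed
  then show thesis using that by blast
qed

section \<open>Infima over nearby sets and minima over meshes\<close>

text \<open>The left side is one of the values whose supremum is the second entry of the maximum.
  Comparing each such infimum with the distance to one fixed point of \<open>F\<close> bounds these
  values by \<open>B\<close>, so the supremum dominates them.\<close>

lemma INF_le_hausdorff_dist:
  assumes N: "is_norm N"
    and B: "\<forall>x\<in>X. \<forall>y\<in>X. N (x - y) \<le> B"
    and sub: "F \<subseteq> X" "G \<subseteq> X" and ne: "F \<noteq> {}" and y: "y \<in> G"
  shows "(INF x\<in>F. N (x - y)) \<le> hausdorff_dist N F G"
proof -
  have lower: "bdd_below ((\<lambda>x. N (x - y)) ` F)" for y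
    using N by (auto simp: is_norm_def intro!: bdd_belowI[of _ 0])
  obtain x where x: "x \<in> F" using ne by blast
  have "bdd_above ((\<lambda>y. INF x\<in>F. N (x - y)) ` G)"
  proof (rule bdd_aboveI2)
    fix y assume "y \<in> G"
    then show "(INF x\<in>F. N (x - y)) \<le> B"
      using B sub x by (intro cINF_lower2[OF lower x]) auto
  qed
  then show ?thesis
    unfolding hausdorff_dist_def by (intro max.coboundedI2 cSUP_upper[OF y])
qed

text \<open>No nearest point is chosen, since \<open>INF a\<in>A. g a\<close> may fail to be
  attained. Instead the bound from \<open>le\<close> is solved for \<open>g a\<close>, and the
  infimum is taken over all \<open>a\<close>.\<close>

lemma INF_le_of_near_point:
  fixes f g :: "'a \<Rightarrow> real"
  assumes "A \<noteq> {}" and lower: "bdd_below (f ` A)" and near: "(INF a\<in>A. g a) \<le> d"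
    and K: "0 \<le> K" and le: "\<And>a. a \<in> A \<Longrightarrow> f a \<le> v + K * g a"
  shows "(INF a\<in>A. f a) \<le> v + K * d"
proof -
  have *: "(INF a\<in>A. f a) \<le> v + K * g a" if "a \<in> A" for a
    using cINF_lower2[OF lower that le[OF that]] .
  show ?thesis
  \<comment> \<open>Solving for \<open>g a\<close> divides by \<open>K\<close>; for
    \<open>K = 0\<close> the bound at any single point of \<open>A\<close> is already the
    claim.\<close>
  proof (cases "K = 0")
    case True
    then show ?thesis using * assms(1) by auto
  next
    case False
    with K have "K > 0" by simp
    have "((INF a\<in>A. f a) - v) / K \<le> (INF a\<in>A. g a)"
      using * \<open>K > 0\<close> by (intro cINF_greatest[OF assms(1)]) (auto simp: field_simps dest: *)
    with near have "((INF a\<in>A. f a) - v) / K \<le> d" by simp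
    then show ?thesis using \<open>K > 0\<close> by (simp add: field_simps)
  qed
qed

lemma MIN_eq_INF:
  fixes f :: "'a \<Rightarrow> real"
  assumes "finite A" "A \<noteq> {}"
  shows "(MIN a\<in>A. f a) = (INF a\<in>A. f a)"
  using assms by (simp add: cInf_eq_Min)

text \<open>The loss at a single stage: \<open>f\<close> is the exact objective, \<open>h\<close>
  its discretized version and \<open>e\<close> the error inherited from later stages. The lower
  bound holds because \<open>M\<close> lies in \<open>A\<close>. For the upper bound, replacing
  \<open>x\<close> by a mesh point near it costs at most \<open>K * d\<close>, and passing from
  \<open>f\<close> to \<open>h\<close> at most \<open>e\<close>.\<close>

lemma MIN_mesh_bounds:
  fixes f h :: "'a::real_vector \<Rightarrow> real"
  assumes "A \<noteq> {}" and M: "finite M" "M \<noteq> {}" "M \<subseteq> A"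
    and lower: "bdd_below (f ` A)"
    and near: "\<And>x. x \<in> A \<Longrightarrow> (INF m\<in>M. N (m - x)) \<le> d"
    and K: "0 \<le> K" and lip: "\<And>x y. x \<in> A \<Longrightarrow> y \<in> A \<Longrightarrow> f x \<le> f y + K * N (x - y)"
    and ge: "\<And>m. m \<in> M \<Longrightarrow> f m \<le> h m" and le: "\<And>m. m \<in> M \<Longrightarrow> h m \<le> f m + e"
  shows "(INF x\<in>A. f x) \<le> (MIN m\<in>M. h m)"
    and "(MIN m\<in>M. h m) \<le> (INF x\<in>A. f x) + (K * d + e)"
proof -
  have "(INF x\<in>A. f x) \<le> h m" if "m \<in> M" for m
    using cINF_lower2[OF lower _ ge[OF that]] M(3) that by blast
  then show "(INF x\<in>A. f x) \<le> (MIN m\<in>M. h m)"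
    using M(1,2) by simp
  have "(INF m\<in>M. h m) - (K * d + e) \<le> f x" if x: "x \<in> A" for x
  proof -
    have "(INF m\<in>M. h m) \<le> (f x + e) + K * d"
    proof (rule INF_le_of_near_point[OF M(2) _ near[OF x] K])
      show "bdd_below (h ` M)" using M(1) by simp
      show "h m \<le> f x + e + K * N (m - x)" if "m \<in> M" for m
        using le[OF that] lip[of m x] M(3) that x by fastforce
    qed
    then show ?thesis by simp
  qed
  then have "(INF m\<in>M. h m) - (K * d + e) \<le> (INF x\<in>A. f x)"
    by (rule cINF_greatest[OF assms(1)])
  then show "(MIN m\<in>M. h m) \<le> (INF x\<in>A. f x) + (K * d + e)"
    by (simp add: MIN_eq_INF M)
qed

lemma MAX_le_MAX_plus:
  fixes f g :: "'a \<Rightarrow> real"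
  assumes "finite A" "A \<noteq> {}" and le: "\<And>a. a \<in> A \<Longrightarrow> f a \<le> g a + k"
  shows "(MAX a\<in>A. f a) \<le> (MAX a\<in>A. g a) + k"
proof -
  have "f a \<le> (MAX a\<in>A. g a) + k" if "a \<in> A" for a
    using le[OF that] Max_ge[OF finite_imageI imageI, OF assms(1) that, of g] by linarith
  then show ?thesis using assms(1,2) by simp
qed

section \<open>The recursion of the Lipschitz constants\<close>

lemma Lv_nonneg: "0 \<le> Lc \<Longrightarrow> 0 \<le> L\<Theta> \<Longrightarrow> 0 \<le> Lv Lc L\<Theta> T t"
  by (simp add: Lv_def sum_nonneg)

lemma Lv_last: "Lv Lc L\<Theta> T T = Lc * (1 + L\<Theta>)"
  by (simp add: Lv_def)

text \<open>Take one factor \<open>1 + L\<Theta>\<close> out of the geometric sum: its first term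
  leaves \<open>1\<close>, which gives the summand \<open>Lc\<close>, and the others leave the sum
  one term shorter. The hypothesis \<open>t < T\<close> keeps the truncated subtractions
  exact.\<close>

lemma Lv_step:
  assumes "t < T"
  shows "Lv Lc L\<Theta> T t = (1 + L\<Theta>) * (Lc + Lv Lc L\<Theta> T (Suc t))"
proof -
  define n where "n = T - Suc t"
  have n: "T - t + 1 = Suc (Suc n)" "T - Suc t + 1 = Suc n"
    using assms unfolding n_def by auto
  have "(\<Sum>k=1..Suc (Suc n). (1 + L\<Theta>) ^ k) = (1 + L\<Theta>) + (\<Sum>k=2..Suc (Suc n). (1 + L\<Theta>) ^ k)"
    by (subst sum.atLeast_Suc_atMost) (auto simp: numeral_2_eq_2)
  also have "(\<Sum>k=2..Suc (Suc n). (1 + L\<Theta>) ^ k) = (\<Sum>k=1..Suc n. (1 + L\<Theta>) ^ Suc k)"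
    using sum.shift_bounds_cl_Suc_ivl[of "\<lambda>k. (1 + L\<Theta>) ^ k" 1 "Suc n"] by (simp add: numeral_2_eq_2)
  also have "\<dots> = (1 + L\<Theta>) * (\<Sum>k=1..Suc n. (1 + L\<Theta>) ^ k)"
    by (simp only: power_Suc sum_distrib_left)
  finally show ?thesis
    unfolding Lv_def n by (simp only: distrib_left mult.left_commute mult.commute)
qed

text \<open>Unifies the last stage, which has no continuation, with the others.\<close>

definition continuation :: "nat \<Rightarrow> (nat \<Rightarrow> 'a \<Rightarrow> 'v \<Rightarrow> real) \<Rightarrow> nat \<Rightarrow> 'a \<Rightarrow> 'v \<Rightarrow> real" where
  "continuation T U t y j = (if t < T then U (Suc t) y j else 0)"

lemma game_value_continuation:
  "game_value V E Q R c T t x i =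
     (MAX j\<in>neighbors V E i. INF y\<in>Theta R Q t j x.
        c x y + continuation T (game_value V E Q R c T) t y j)"
  by (subst game_value.simps) (simp add: continuation_def)

lemma discrete_game_value_continuation:
  "discrete_game_value V E Q R c T Xh t x i =
     (MAX j\<in>neighbors V E i. MIN y\<in>Xh t \<inter> Theta R Q t j x.
        c x y + continuation T (discrete_game_value V E Q R c T Xh) t y j)"
  by (subst discrete_game_value.simps) (simp add: continuation_def)

section \<open>Lipschitz continuity of the exact game value\<close>

text \<open>States the assumptions in the form the estimates consume: solidity enters as
  nonemptiness, and compactness of \<open>X\<close> as the bound \<open>B\<close>.\<close>

locale chasing_game =
  fixes N :: "'a::real_vector \<Rightarrow> real"
    and X :: "'a set"
    and T :: nat
    and V :: "'v set"
    and E :: "('v \<times> 'v) set"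
    and Q :: "nat \<Rightarrow> 'v \<Rightarrow> 'a set"
    and R :: "'a \<Rightarrow> 'a set"
    and c :: "'a \<Rightarrow> 'a \<Rightarrow> real"
    and Lc L\<Theta> B :: real
  assumes norm: "is_norm N"
    and bounded: "\<forall>x\<in>X. \<forall>y\<in>X. N (x - y) \<le> B"
    and horizon: "T \<ge> 1"
    and graph: "finite V" "V \<noteq> {}"
    and neighbors_nonempty: "i \<in> V \<Longrightarrow> neighbors V E i \<noteq> {}"
    and Q_subset: "t \<le> T \<Longrightarrow> i \<in> V \<Longrightarrow> Q t i \<subseteq> X"
    and Q_nonempty: "i \<in> V \<Longrightarrow> Q 0 i \<noteq> {}"
    and c_nonneg: "x \<in> X \<Longrightarrow> y \<in> X \<Longrightarrow> 0 \<le> c x y"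
    and Theta_nonempty: "t \<in> {1..T} \<Longrightarrow> i \<in> V \<Longrightarrow> j \<in> neighbors V E i \<Longrightarrow> x \<in> Q (t - 1) i \<Longrightarrow>
           Theta R Q t j x \<noteq> {}"
    and Lc_nonneg: "0 \<le> Lc"
    and c_lipschitz: "x \<in> X \<Longrightarrow> y \<in> X \<Longrightarrow> x' \<in> X \<Longrightarrow> y' \<in> X \<Longrightarrow>
           \<bar>c x y - c x' y'\<bar> \<le> Lc * (N (x - x') + N (y - y'))"
    and L\<Theta>_nonneg: "0 \<le> L\<Theta>"
    and Theta_lipschitz: "t \<in> {1..T} \<Longrightarrow> i \<in> V \<Longrightarrow> j \<in> neighbors V E i \<Longrightarrow>
           x \<in> Q (t - 1) i \<Longrightarrow> x' \<in> Q (t - 1) i \<Longrightarrow>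
           hausdorff_dist N (Theta R Q t j x) (Theta R Q t j x') \<le> L\<Theta> * N (x - x')"
begin

abbreviation U :: "nat \<Rightarrow> 'a \<Rightarrow> 'v \<Rightarrow> real" where
  "U \<equiv> game_value V E Q R c T"

abbreviation L :: "nat \<Rightarrow> real" where
  "L \<equiv> Lv Lc L\<Theta> T"

text \<open>The case distinction is needed since \<open>L (Suc T)\<close> is not \<open>0\<close> but \<open>L T\<close>, by truncated subtraction.\<close>

definition Lcont :: "nat \<Rightarrow> real" where
  "Lcont t = (if t < T then L (Suc t) else 0)"

lemma N_nonneg: "0 \<le> N x"
  using norm by (simp add: is_norm_def)

lemma N_zero: "N 0 = 0"
  using norm by (simp add: is_norm_def)

lemma Lcont_nonneg: "0 \<le> Lcont t"
  by (simp add: Lcont_def Lv_nonneg Lc_nonneg L\<Theta>_nonneg)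

text \<open>Setting \<open>Lcont T = 0\<close> extends the recursion to the last stage, so that the
  inductions below treat all stages alike.\<close>

lemma Lv_eq_Lcont: "t \<le> T \<Longrightarrow> L t = (1 + L\<Theta>) * (Lc + Lcont t)"
  by (cases "t = T") (simp_all add: Lcont_def Lv_last Lv_step)

lemma finite_neighbors: "finite (neighbors V E i)"
  using graph(1) by (simp add: neighbors_def)

lemma neighbors_subset: "j \<in> neighbors V E i \<Longrightarrow> j \<in> V"
  by (simp add: neighbors_def)

lemma Theta_subset_Q: "Theta R Q t j x \<subseteq> Q t j"
  by (simp add: Theta_def)

lemma Q_in_X: "t \<le> T \<Longrightarrow> i \<in> V \<Longrightarrow> x \<in> Q t i \<Longrightarrow> x \<in> X"
  using Q_subset by blast

text \<open>Bounds every infimum of the recursion from below by \<open>0\<close>, so that each of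
  them is a genuine greatest lower bound.\<close>

lemma game_value_nonneg:
  assumes "1 \<le> t" "t \<le> T" "i \<in> V" "x \<in> Q (t - 1) i"
  shows "0 \<le> U t x i"
  using assms
proof (induction "T - t" arbitrary: t i x rule: less_induct)
  case (less t i x)
  \<comment> \<open>A maximum dominates each of its entries, so one neighbor suffices.\<close>
  obtain j where j: "j \<in> neighbors V E i" using neighbors_nonempty less.prems by blast
  have x: "x \<in> X" using Q_in_X[of "t - 1"] less.prems by simp
  have "0 \<le> c x y + continuation T U t y j" if "y \<in> Theta R Q t j x" for y
  proof -
    have y: "y \<in> Q t j" using that Theta_subset_Q by blast
    then have "0 \<le> continuation T U t y j"
      using less.hyps[of "Suc t" j y] neighbors_subset[OF j] less.prems
      by (simp add: continuation_def)
    moreover have "y \<in> X" using Q_in_X y neighbors_subset[OF j] less.prems by blast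
    ultimately show ?thesis using c_nonneg[OF x] by force
  qed
  then have "0 \<le> (INF y\<in>Theta R Q t j x. c x y + continuation T U t y j)"
    using less.prems j by (intro cINF_greatest Theta_nonempty) auto
  also have "\<dots> \<le> U t x i"
    unfolding game_value_continuation[of V E Q R c T t x i]
    using j finite_neighbors by (intro Max_ge) auto
  finally show ?case .
qed

lemma continuation_nonneg:
  assumes "1 \<le> t" "t \<le> T" "j \<in> V" "y \<in> Q t j"
  shows "0 \<le> continuation T U t y j"
  using assms game_value_nonneg[of "Suc t" j y] by (simp add: continuation_def)

lemma bdd_below_stage:
  assumes "1 \<le> t" "t \<le> T" "j \<in> V" "x \<in> X"
  shows "bdd_below ((\<lambda>y. c x y + continuation T U t y j) ` Theta R Q t j x)"
proof (rule bdd_belowI2)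
  fix y assume "y \<in> Theta R Q t j x"
  then have "y \<in> Q t j" using Theta_subset_Q by blast
  then show "0 \<le> c x y + continuation T U t y j"
    using assms continuation_nonneg c_nonneg Q_in_X by (simp add: add_nonneg_nonneg)
qed

text \<open>Fix a neighbor \<open>j\<close> and a point \<open>y'\<close> feasible from
  \<open>x'\<close>. The Hausdorff bound puts points feasible from \<open>x\<close> at infimal
  distance at most \<open>L\<Theta> * N (x - x')\<close> from \<open>y'\<close>, and the stage
  objective is Lipschitz in both arguments. Taking the infimum over \<open>y'\<close> and the
  maximum over \<open>j\<close> preserves the bound.\<close>

lemma game_value_lipschitz:
  assumes "1 \<le> t" "t \<le> T" "i \<in> V" "x \<in> Q (t - 1) i" "x' \<in> Q (t - 1) i"
  shows "U t x i \<le> U t x' i + L t * N (x - x')"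
  using assms
proof (induction "T - t" arbitrary: t i x x' rule: less_induct)
  case (less t i x x')
  have t: "t \<in> {1..T}" using less.prems by simp
  have x: "x \<in> X" and x': "x' \<in> X"
    using Q_in_X[of "t - 1"] less.prems by auto
  have "(INF y\<in>Theta R Q t j x. c x y + continuation T U t y j)
      \<le> (INF y\<in>Theta R Q t j x'. c x' y + continuation T U t y j) + L t * N (x - x')"
    if j: "j \<in> neighbors V E i" for j
  proof -
    have jV: "j \<in> V" using neighbors_subset[OF j] .
    have in_Q: "y \<in> Q t j" and in_X: "y \<in> X" if "y \<in> Theta R Q t j z" for y z
      using that Theta_subset_Q Q_in_X less.prems jV by blast+
    \<comment> \<open>Points of \<open>Q t j\<close> are the admissible states of stage
      \<open>Suc t\<close> at vertex \<open>j\<close>, so the induction hypothesis applies; for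
      \<open>t = T\<close> both continuations are \<open>0\<close>.\<close>
    have cont: "continuation T U t y j \<le> continuation T U t y' j + Lcont t * N (y - y')"
      if "y \<in> Q t j" "y' \<in> Q t j" for y y'
      using less.hyps[of "Suc t" j y y'] less.prems jV that
      by (simp add: continuation_def Lcont_def)
    have "(INF y\<in>Theta R Q t j x. c x y + continuation T U t y j) - L t * N (x - x')
        \<le> c x' y' + continuation T U t y' j" if y': "y' \<in> Theta R Q t j x'" for y'
    proof -
      have "(INF y\<in>Theta R Q t j x. N (y - y'))
          \<le> hausdorff_dist N (Theta R Q t j x) (Theta R Q t j x')"
        by (rule INF_le_hausdorff_dist[OF norm bounded _ _ Theta_nonempty[OF t less.prems(3) j less.prems(4)] y'])
          (use in_X in auto)
      also have "\<dots> \<le> L\<Theta> * N (x - x')"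
        using Theta_lipschitz[OF t less.prems(3) j less.prems(4,5)] .
      finally have near: "(INF y\<in>Theta R Q t j x. N (y - y')) \<le> L\<Theta> * N (x - x')" .
      have "(INF y\<in>Theta R Q t j x. c x y + continuation T U t y j)
          \<le> (c x' y' + continuation T U t y' j + Lc * N (x - x')) + (Lc + Lcont t) * (L\<Theta> * N (x - x'))"
      proof (rule INF_le_of_near_point[OF _ _ near])
        show "Theta R Q t j x \<noteq> {}"
          using Theta_nonempty[OF t less.prems(3) j less.prems(4)] .
        show "bdd_below ((\<lambda>y. c x y + continuation T U t y j) ` Theta R Q t j x)"
          using bdd_below_stage[OF less.prems(1,2) jV x] .
        show "0 \<le> Lc + Lcont t" using Lc_nonneg Lcont_nonneg by simp
        fix y assume y: "y \<in> Theta R Q t j x"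
        have "c x y \<le> c x' y' + Lc * (N (x - x') + N (y - y'))"
          using c_lipschitz[OF x in_X[OF y] x' in_X[OF y']] by linarith
        with cont[OF in_Q[OF y] in_Q[OF y']]
        show "c x y + continuation T U t y j
            \<le> c x' y' + continuation T U t y' j + Lc * N (x - x') + (Lc + Lcont t) * N (y - y')"
          by (simp add: algebra_simps)
      qed
      \<comment> \<open>The state \<open>x\<close> itself enters only the cost, whereas the factor
        \<open>1 + L\<Theta>\<close> also charges its displacement to the continuation. The excess
        \<open>Lcont t * N (x - x')\<close> is nonnegative and is dropped.\<close>
      moreover have "L t * N (x - x') =
          Lc * N (x - x') + (Lc + Lcont t) * (L\<Theta> * N (x - x')) + Lcont t * N (x - x')"
        using Lv_eq_Lcont[of t] less.prems by (simp add: algebra_simps)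
      moreover have "0 \<le> Lcont t * N (x - x')" using Lcont_nonneg N_nonneg by simp
      ultimately show ?thesis by linarith
    qed
    then have "(INF y\<in>Theta R Q t j x. c x y + continuation T U t y j) - L t * N (x - x')
        \<le> (INF y\<in>Theta R Q t j x'. c x' y + continuation T U t y j)"
      by (rule cINF_greatest[OF Theta_nonempty[OF t less.prems(3) j less.prems(5)]])
    then show ?thesis by linarith
  qed
  then show ?case
    unfolding game_value_continuation[of V E Q R c T t x i] game_value_continuation[of V E Q R c T t x' i]
    by (intro MAX_le_MAX_plus finite_neighbors neighbors_nonempty less.prems)
qed

text \<open>With the state \<open>x\<close> fixed, only the second argument of the cost moves. This
  yields the constant \<open>K\<close> for the mesh estimate at stage \<open>t\<close>.\<close>

lemma stage_lipschitz:
  assumes t: "1 \<le> t" "t \<le> T" and j: "j \<in> V" and x: "x \<in> X" and y: "y \<in> Q t j" "y' \<in> Q t j"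
  shows "c x y + continuation T U t y j
    \<le> c x y' + continuation T U t y' j + (Lc + Lcont t) * N (y - y')"
proof -
  have "y \<in> X" "y' \<in> X" using Q_in_X t j y by blast+
  then have "c x y \<le> c x y' + Lc * N (y - y')"
    using c_lipschitz[OF x \<open>y \<in> X\<close> x \<open>y' \<in> X\<close>] by (simp add: N_zero)
  moreover have "continuation T U t y j \<le> continuation T U t y' j + Lcont t * N (y - y')"
    using game_value_lipschitz[of "Suc t" j y y'] assms by (simp add: continuation_def Lcont_def)
  ultimately show ?thesis by (simp add: algebra_simps)
qed

end

section \<open>Accumulation of the discretization losses\<close>

locale discretized_chasing_game = chasing_game N X T V E Q R c Lc L\<Theta> B
  for N :: "'a::real_vector \<Rightarrow> real" and X T and V :: "'v set" and E Q R c Lc L\<Theta> B +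
  fixes \<delta> :: "nat \<Rightarrow> real" and Xh :: "nat \<Rightarrow> 'a set"
  assumes finite_mesh: "t \<le> T \<Longrightarrow> finite (Xh t)"
    and initial_mesh: "i \<in> V \<Longrightarrow> x \<in> Q 0 i \<Longrightarrow>
          Xh 0 \<inter> Q 0 i \<noteq> {} \<and> (MIN m\<in>Xh 0 \<inter> Q 0 i. N (m - x)) \<le> \<delta> 0"
    and stage_mesh: "t \<in> {1..T} \<Longrightarrow> i \<in> V \<Longrightarrow> j \<in> neighbors V E i \<Longrightarrow>
          m \<in> Xh (t - 1) \<inter> Q (t - 1) i \<Longrightarrow> x \<in> Theta R Q t j m \<Longrightarrow>
          Xh t \<inter> Theta R Q t j m \<noteq> {} \<and> (MIN m'\<in>Xh t \<inter> Theta R Q t j m. N (m' - x)) \<le> \<delta> t"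
begin

abbreviation Uh :: "nat \<Rightarrow> 'a \<Rightarrow> 'v \<Rightarrow> real" where
  "Uh \<equiv> discrete_game_value V E Q R c T Xh"

text \<open>The total loss of stages \<open>t\<close> to \<open>T\<close>. The last summand is
  \<open>Lc * \<delta> T\<close>, as \<open>Lcont T = 0\<close>, and \<open>err (Suc T)\<close> is
  an empty sum, matching the absent continuation.\<close>

definition err :: "nat \<Rightarrow> real" where
  "err t = (\<Sum>\<tau>=t..T. (Lc + Lcont \<tau>) * \<delta> \<tau>)"

text \<open>Backward induction with \<open>MIN_mesh_bounds\<close>: stage \<open>t\<close> adds
  \<open>(Lc + Lcont t) * \<delta> t\<close> to the error \<open>err (Suc t)\<close> of its
  continuation. The states are mesh points because the mesh condition on feasible sets speaks only
  of these.\<close>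

lemma discrete_game_value_bounds:
  assumes "1 \<le> t" "t \<le> T" "i \<in> V" "x \<in> Xh (t - 1) \<inter> Q (t - 1) i"
  shows "U t x i \<le> Uh t x i \<and> Uh t x i \<le> U t x i + err t"
  using assms
proof (induction "T - t" arbitrary: t i x rule: less_induct)
  case (less t i x)
  have t: "t \<in> {1..T}" using less.prems by simp
  have x: "x \<in> X" using Q_in_X[of "t - 1"] less.prems by auto
  have err: "err t = (Lc + Lcont t) * \<delta> t + err (Suc t)"
    unfolding err_def using less.prems by (simp add: sum.atLeast_Suc_atMost)
  have bounds: "(INF y\<in>Theta R Q t j x. c x y + continuation T U t y j)
        \<le> (MIN y\<in>Xh t \<inter> Theta R Q t j x. c x y + continuation T Uh t y j)"
    "(MIN y\<in>Xh t \<inter> Theta R Q t j x. c x y + continuation T Uh t y j)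
        \<le> (INF y\<in>Theta R Q t j x. c x y + continuation T U t y j) + err t"
    if j: "j \<in> neighbors V E i" for j
  proof -
    have jV: "j \<in> V" using neighbors_subset[OF j] .
    have ne: "Theta R Q t j x \<noteq> {}"
      using Theta_nonempty[OF t less.prems(3) j] less.prems(4) by blast
    have fin: "finite (Xh t \<inter> Theta R Q t j x)"
      using finite_mesh less.prems(2) by blast
    \<comment> \<open>The mesh condition is conditional on a point of the exact feasible set;
      \<open>ne\<close> provides one.\<close>
    have mesh_ne: "Xh t \<inter> Theta R Q t j x \<noteq> {}"
      using ne stage_mesh[OF t less.prems(3) j less.prems(4)] by blast
    have near: "(INF m\<in>Xh t \<inter> Theta R Q t j x. N (m - y)) \<le> \<delta> t" if "y \<in> Theta R Q t j x" for y
      using stage_mesh[OF t less.prems(3) j less.prems(4) that] MIN_eq_INF[OF fin mesh_ne] by metis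
    have lower: "bdd_below ((\<lambda>y. c x y + continuation T U t y j) ` Theta R Q t j x)"
      using bdd_below_stage[OF less.prems(1,2) jV x] .
    have K: "0 \<le> Lc + Lcont t" using Lc_nonneg Lcont_nonneg by simp
    have lip: "c x y + continuation T U t y j
        \<le> c x y' + continuation T U t y' j + (Lc + Lcont t) * N (y - y')"
      if "y \<in> Theta R Q t j x" "y' \<in> Theta R Q t j x" for y y'
      using stage_lipschitz[OF less.prems(1,2) jV x] that Theta_subset_Q by blast
    have cont: "continuation T U t m j \<le> continuation T Uh t m j"
      "continuation T Uh t m j \<le> continuation T U t m j + err (Suc t)"
      if "m \<in> Xh t \<inter> Theta R Q t j x" for m
    proof -
      \<comment> \<open>A mesh point chosen at stage \<open>t\<close> is again a mesh state of stage
        \<open>Suc t\<close>, as the induction hypothesis requires.\<close>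
      have "m \<in> Xh t \<inter> Q t j" using that Theta_subset_Q by blast
      then show "continuation T U t m j \<le> continuation T Uh t m j"
        "continuation T Uh t m j \<le> continuation T U t m j + err (Suc t)"
        using less.hyps[of "Suc t" j m] less.prems jV by (auto simp: continuation_def err_def)
    qed
    note mesh = MIN_mesh_bounds[OF ne fin mesh_ne _ lower near K lip,
        where h = "\<lambda>y. c x y + continuation T Uh t y j" and e = "err (Suc t)"]
    show "(INF y\<in>Theta R Q t j x. c x y + continuation T U t y j)
        \<le> (MIN y\<in>Xh t \<inter> Theta R Q t j x. c x y + continuation T Uh t y j)"
      using cont by (intro mesh(1)) auto
    show "(MIN y\<in>Xh t \<inter> Theta R Q t j x. c x y + continuation T Uh t y j)
        \<le> (INF y\<in>Theta R Q t j x. c x y + continuation T U t y j) + err t"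
      unfolding err using cont by (intro mesh(2)) (auto simp: add.assoc)
  qed
  note MAX_le = MAX_le_MAX_plus[OF finite_neighbors neighbors_nonempty[OF less.prems(3)]]
  note rec = game_value_continuation[of V E Q R c T t x i]
    discrete_game_value_continuation[of V E Q R c T Xh t x i]
  have "U t x i \<le> Uh t x i + 0"
    unfolding rec by (intro MAX_le) (use bounds(1) in simp)
  moreover have "Uh t x i \<le> U t x i + err t"
    unfolding rec by (intro MAX_le bounds(2))
  ultimately show ?case by simp
qed

text \<open>The choice of the initial state incurs no stage cost, so the function minimized is
  \<open>U 1\<close> itself and the mesh at time \<open>0\<close> is charged with \<open>L 1\<close>
  alone; \<open>err 1\<close> covers all later stages.\<close>

lemma discrete_value_bounds:
  shows "optimal_value V E Q R c T \<le> discrete_value V E Q R c T Xh"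
    and "discrete_value V E Q R c T Xh \<le> optimal_value V E Q R c T + (L 1 * \<delta> 0 + err 1)"
proof -
  have bounds: "(INF x\<in>Q 0 i. U 1 x i) \<le> (MIN x\<in>Xh 0 \<inter> Q 0 i. Uh 1 x i)"
    "(MIN x\<in>Xh 0 \<inter> Q 0 i. Uh 1 x i) \<le> (INF x\<in>Q 0 i. U 1 x i) + (L 1 * \<delta> 0 + err 1)"
    if i: "i \<in> V" for i
  proof -
    have fin: "finite (Xh 0 \<inter> Q 0 i)" using finite_mesh by blast
    have mesh_ne: "Xh 0 \<inter> Q 0 i \<noteq> {}" using Q_nonempty initial_mesh i by blast
    have near: "(INF m\<in>Xh 0 \<inter> Q 0 i. N (m - x)) \<le> \<delta> 0" if "x \<in> Q 0 i" for x
      using initial_mesh[OF i that] MIN_eq_INF[OF fin mesh_ne] by metis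
    have lower: "bdd_below ((\<lambda>x. U 1 x i) ` Q 0 i)"
      using game_value_nonneg[of 1 i] horizon i by (intro bdd_belowI2[of _ 0]) auto
    have K: "0 \<le> L 1" using Lv_nonneg Lc_nonneg L\<Theta>_nonneg by blast
    have lip: "U 1 x i \<le> U 1 y i + L 1 * N (x - y)" if "x \<in> Q 0 i" "y \<in> Q 0 i" for x y
      using game_value_lipschitz[of 1 i x y] horizon i that by simp
    have Uh: "U 1 m i \<le> Uh 1 m i" "Uh 1 m i \<le> U 1 m i + err 1" if "m \<in> Xh 0 \<inter> Q 0 i" for m
      using discrete_game_value_bounds[of 1 i m] horizon i that by auto
    note mesh = MIN_mesh_bounds[OF Q_nonempty[OF i] fin mesh_ne Int_lower2 lower near K lip Uh]
    show "(INF x\<in>Q 0 i. U 1 x i) \<le> (MIN x\<in>Xh 0 \<inter> Q 0 i. Uh 1 x i)"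
      by (rule mesh(1))
    show "(MIN x\<in>Xh 0 \<inter> Q 0 i. Uh 1 x i) \<le> (INF x\<in>Q 0 i. U 1 x i) + (L 1 * \<delta> 0 + err 1)"
      by (rule mesh(2))
  qed
  have "optimal_value V E Q R c T \<le> discrete_value V E Q R c T Xh + 0"
    unfolding optimal_value_def discrete_value_def
    by (intro MAX_le_MAX_plus graph) (use bounds(1) in simp)
  then show "optimal_value V E Q R c T \<le> discrete_value V E Q R c T Xh" by simp
  show "discrete_value V E Q R c T Xh \<le> optimal_value V E Q R c T + (L 1 * \<delta> 0 + err 1)"
    unfolding optimal_value_def discrete_value_def
    by (intro MAX_le_MAX_plus graph bounds(2))
qed

lemma discretization_error_eq: "discretization_error Lc L\<Theta> T \<delta> = L 1 * \<delta> 0 + err 1"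
proof -
  \<comment> \<open>The last stage is split off because its constant is \<open>Lc\<close>, while
    \<open>Lcont \<tau> = L (\<tau> + 1)\<close> for earlier \<open>\<tau>\<close>. For
    \<open>T = 1\<close> the remaining sum is empty.\<close>
  have "{1..T} = insert T {1..T - 1}" using horizon by auto
  then have "err 1 = Lc * \<delta> T + (\<Sum>\<tau>=1..T - 1. (Lc + Lcont \<tau>) * \<delta> \<tau>)"
    using horizon by (simp add: err_def Lcont_def)
  also have "(\<Sum>\<tau>=1..T - 1. (Lc + Lcont \<tau>) * \<delta> \<tau>) = (\<Sum>\<tau>=1..T - 1. (Lc + L (\<tau> + 1)) * \<delta> \<tau>)"
    by (intro sum.cong) (auto simp: Lcont_def)
  finally show ?thesis by (simp add: discretization_error_def)
qed

end

section \<open>Application to compact subsets of \<open>real ^ 'd\<close>\<close>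

theorem corollary1:
  fixes N :: "real ^ 'd \<Rightarrow> real"
    and X :: "(real ^ 'd) set"
    and T :: nat
    and V :: "'v set"
    and E :: "('v \<times> 'v) set"
    and Q :: "nat \<Rightarrow> 'v \<Rightarrow> (real ^ 'd) set"
    and R :: "real ^ 'd \<Rightarrow> (real ^ 'd) set"
    and c :: "real ^ 'd \<Rightarrow> real ^ 'd \<Rightarrow> real"
    and Lc L\<Theta> :: real
    and \<delta> :: "nat \<Rightarrow> real"
    and Xh :: "nat \<Rightarrow> (real ^ 'd) set"
  assumes norm: "is_norm N"
    and X_compact: "compact X"
    and horizon: "T \<ge> 1"
    and graph: "finite V" "V \<noteq> {}" "E \<subseteq> V \<times> V"
    and neighbors_nonempty: "\<forall>i\<in>V. neighbors V E i \<noteq> {}"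
    and Q_subset: "\<forall>t\<le>T. \<forall>i\<in>V. Q t i \<subseteq> X"
    and R_corr: "correspondence X X R"
    and c_nonneg: "\<forall>x\<in>X. \<forall>y\<in>X. 0 \<le> c x y"
    and A1: "\<forall>x\<in>X. solid (R x) \<and> compact (R x) \<and> convex (R x)"
    and A2: "\<forall>t\<le>T. \<forall>i\<in>V. solid (Q t i) \<and> compact (Q t i) \<and> convex (Q t i)"
    and A3: "\<forall>t\<in>{1..T}. \<forall>i\<in>V. \<forall>j\<in>neighbors V E i. \<forall>x\<in>Q (t - 1) i.
               interior (R x \<inter> Q t j) \<noteq> {}"
    and A4: "continuous_correspondence X X R"
    and Lc_nonneg: "0 \<le> Lc"
    and A5: "\<forall>x\<in>X. \<forall>y\<in>X. \<forall>x'\<in>X. \<forall>y'\<in>X.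
               \<bar>c x y - c x' y'\<bar> \<le> Lc * (N (x - x') + N (y - y'))"
    and L\<Theta>_nonneg: "0 \<le> L\<Theta>"
    and A6: "\<forall>t\<in>{1..T}. \<forall>i\<in>V. \<forall>j\<in>V. i \<in> neighbors V E j \<longrightarrow>
               (\<forall>x\<in>Q (t - 1) j. \<forall>x'\<in>Q (t - 1) j.
                  hausdorff_dist N (Theta R Q t i x) (Theta R Q t i x') \<le> L\<Theta> * N (x - x'))"
    and \<delta>_nonneg: "\<forall>t\<le>T. 0 \<le> \<delta> t"
    and meshes: "\<forall>t\<le>T. finite (Xh t) \<and> Xh t \<subseteq> X"
    and D1: "\<forall>t\<le>T. \<forall>x\<in>X. Xh t \<noteq> {} \<and> (MIN xh\<in>Xh t. N (xh - x)) \<le> \<delta> t"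
    and D2: "\<forall>i\<in>V. \<forall>x\<in>Q 0 i.
               Xh 0 \<inter> Q 0 i \<noteq> {} \<and> (MIN xh\<in>Xh 0 \<inter> Q 0 i. N (xh - x)) \<le> \<delta> 0"
    and D3: "\<forall>t\<in>{1..T}. \<forall>j\<in>V. \<forall>i\<in>neighbors V E j. \<forall>xh'\<in>Xh (t - 1) \<inter> Q (t - 1) j.
               \<forall>x\<in>Theta R Q t i xh'.
                 Xh t \<inter> Theta R Q t i xh' \<noteq> {} \<and>
                 (MIN xh\<in>Xh t \<inter> Theta R Q t i xh'. N (xh - x)) \<le> \<delta> t"
  shows "0 \<le> discrete_value V E Q R c T Xh - optimal_value V E Q R c T \<and>
         discrete_value V E Q R c T Xh - optimal_value V E Q R c T
           \<le> discretization_error Lc L\<Theta> T \<delta>"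
proof -
  \<comment> \<open>Compactness of \<open>X\<close> yields the diameter bound with respect to
    \<open>N\<close>, the one locale parameter not given by the data.\<close>
  obtain B where B: "\<forall>x\<in>X. \<forall>y\<in>X. N (x - y) \<le> B"
    using is_norm_bounded_diff[OF norm] X_compact compact_imp_bounded by blast
  interpret discretized_chasing_game N X T V E Q R c Lc L\<Theta> B \<delta> Xh
  proof
    show "Q 0 i \<noteq> {}" if "i \<in> V" for i
      using A2 that by (fastforce simp: solid_def)
    show "Theta R Q t j x \<noteq> {}"
      if "t \<in> {1..T}" "i \<in> V" "j \<in> neighbors V E i" "x \<in> Q (t - 1) i" for t i j x
      using A3 that interior_subset unfolding Theta_def by fastforce
    \<comment> \<open>The vertex names are exchanged: \<open>A6\<close> calls the source
      \<open>j\<close> and its neighbor \<open>i\<close>. Membership of the neighbor in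
      \<open>V\<close> comes from \<open>neighbors_def\<close>.\<close>
    show "hausdorff_dist N (Theta R Q t j x) (Theta R Q t j x') \<le> L\<Theta> * N (x - x')"
      if "t \<in> {1..T}" "i \<in> V" "j \<in> neighbors V E i" "x \<in> Q (t - 1) i" "x' \<in> Q (t - 1) i"
      for t i j x x'
      using A6 that by (simp add: neighbors_def)
    show "neighbors V E i \<noteq> {}" if "i \<in> V" for i
      using neighbors_nonempty that by blast
    show "Q t i \<subseteq> X" if "t \<le> T" "i \<in> V" for t i
      using Q_subset that by blast
    show "0 \<le> c x y" if "x \<in> X" "y \<in> X" for x y
      using c_nonneg that by blast
    show "\<bar>c x y - c x' y'\<bar> \<le> Lc * (N (x - x') + N (y - y'))"
      if "x \<in> X" "y \<in> X" "x' \<in> X" "y' \<in> X" for x y x' y'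
      using A5 that by blast
    show "finite (Xh t)" if "t \<le> T" for t
      using meshes that by blast
    show "Xh 0 \<inter> Q 0 i \<noteq> {} \<and> (MIN m\<in>Xh 0 \<inter> Q 0 i. N (m - x)) \<le> \<delta> 0"
      if "i \<in> V" "x \<in> Q 0 i" for i x
      using D2[rule_format, OF that] .
    show "Xh t \<inter> Theta R Q t j m \<noteq> {} \<and> (MIN m'\<in>Xh t \<inter> Theta R Q t j m. N (m' - x)) \<le> \<delta> t"
      if "t \<in> {1..T}" "i \<in> V" "j \<in> neighbors V E i" "m \<in> Xh (t - 1) \<inter> Q (t - 1) i"
        "x \<in> Theta R Q t j m" for t i j m x
      using D3[rule_format, OF that] .
  qed (fact norm B horizon graph Lc_nonneg L\<Theta>_nonneg)+
  show ?thesis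
    using discrete_value_bounds discretization_error_eq by simp
qed

end
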